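(* Every finite distributive lattice $\mathcal{L}=(L,\leq)$ has the intersection property, i.e. for all $x,y\in L$ there is $z\in L$ with $\Psi(x)\cap\Psi(y)=\Psi(z)$. Consequently, the core label order $\mathrm{CLO}(\mathcal{L})$ is a meet-semilattice, and it is a lattice if and only if $\mathcal{L}$ is isomorphic to a Boolean lattice.
   Context: Finite distributive lattices are congruence uniform. For a finite congruence-uniform lattice: an element $j$ is join-irreducible if $j=x\vee y$ implies $j\in\{x,y\}$, and then $j$ has a unique lower cover $j_*$. Cover relations $x\lessdot y$ and $u\lessdot v$ are perspective if either ($v\vee x=y$ and $v\wedge x=u$) or ($u\vee y=v$ and $u\wedge y=x$). For each cover relation $x\lessdot y$ there is a unique join-irreducible $j$ with $(x,y)$ and $(j_*,j)$ perspective; write $\gamma(x,y)=j$. The nucleus of $x$ is $x_\downarrow=\bigwedge_{y\lessdot x}y$ (with $x_\downarrow=x$ if $x$ has no lower cover), and $\Psi(x)=\{\gamma(u,v)\mid x_\downarrow\le u\lessdot v\le x\}$. The core label order $\mathrm{CLO}(\mathcal{L})$ is $L$ ordered by $x\sqsubseteq y$ iff $\Psi(x)\subseteq\Psi(y)$. A Boolean lattice is a lattice isomorphic to the power set of a finite set ordered by inclusion. *)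

theory Defs
  imports "HOL-Algebra.Lattice"
begin

locale distributive_lattice = lattice +
  assumes meet_join_distrib:
    "\<lbrakk>x \<in> carrier L; y \<in> carrier L; z \<in> carrier L\<rbrakk>
      \<Longrightarrow> x \<sqinter> (y \<squnion> z) = (x \<sqinter> y) \<squnion> (x \<sqinter> z)"

definition covers :: "('a, 'b) gorder_scheme \<Rightarrow> 'a \<Rightarrow> 'a \<Rightarrow> bool" where
  "covers L x y \<longleftrightarrow> x \<in> carrier L \<and> y \<in> carrier L \<and> x \<sqsubset>\<^bsub>L\<^esub> y \<and>
     \<not> (\<exists>z\<in>carrier L. x \<sqsubset>\<^bsub>L\<^esub> z \<and> z \<sqsubset>\<^bsub>L\<^esub> y)"

text \<open>The least element satisfies the decomposition condition vacuously, but it has no lower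
  cover; as usual it is not counted as join-irreducible.\<close>

definition join_irreducible :: "('a, 'b) gorder_scheme \<Rightarrow> 'a \<Rightarrow> bool" where
  "join_irreducible L j \<longleftrightarrow> j \<in> carrier L \<and> \<not> least L j (carrier L) \<and>
     (\<forall>x\<in>carrier L. \<forall>y\<in>carrier L. j = x \<squnion>\<^bsub>L\<^esub> y \<longrightarrow> j \<in> {x, y})"

text \<open>The element \<open>j\<^sub>*\<close>; meaningful only if \<open>j\<close> has exactly one lower cover.\<close>

definition lower_cover :: "('a, 'b) gorder_scheme \<Rightarrow> 'a \<Rightarrow> 'a" where
  "lower_cover L j = (THE k. covers L k j)"

definition perspective :: "('a, 'b) gorder_scheme \<Rightarrow> 'a \<times> 'a \<Rightarrow> 'a \<times> 'a \<Rightarrow> bool" where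
  "perspective L = (\<lambda>(x, y) (u, v). covers L x y \<and> covers L u v \<and>
     ((v \<squnion>\<^bsub>L\<^esub> x = y \<and> v \<sqinter>\<^bsub>L\<^esub> x = u) \<or> (u \<squnion>\<^bsub>L\<^esub> y = v \<and> u \<sqinter>\<^bsub>L\<^esub> y = x)))"

text \<open>The label \<open>\<gamma>(x, y)\<close> of a cover relation.  It is well defined in every finite
  congruence-uniform lattice, in particular in every finite distributive lattice.\<close>

definition cover_label :: "('a, 'b) gorder_scheme \<Rightarrow> 'a \<Rightarrow> 'a \<Rightarrow> 'a" where
  "cover_label L x y = (THE j. join_irreducible L j \<and> perspective L (x, y) (lower_cover L j, j))"

definition nucleus :: "('a, 'b) gorder_scheme \<Rightarrow> 'a \<Rightarrow> 'a" where
  "nucleus L x = (if \<exists>y. covers L y x then \<Sqinter>\<^bsub>L\<^esub>{y. covers L y x} else x)"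

text \<open>\<open>\<Psi>(x)\<close> in the literature.\<close>

definition core_labels :: "('a, 'b) gorder_scheme \<Rightarrow> 'a \<Rightarrow> 'a set" where
  "core_labels L x = {cover_label L u v | u v. nucleus L x \<sqsubseteq>\<^bsub>L\<^esub> u \<and> covers L u v \<and> v \<sqsubseteq>\<^bsub>L\<^esub> x}"

definition intersection_property :: "('a, 'b) gorder_scheme \<Rightarrow> bool" where
  "intersection_property L \<longleftrightarrow>
     (\<forall>x\<in>carrier L. \<forall>y\<in>carrier L. \<exists>z\<in>carrier L.
        core_labels L x \<inter> core_labels L y = core_labels L z)"

definition CLO :: "('a, 'b) gorder_scheme \<Rightarrow> 'a gorder" where
  "CLO L = \<lparr>carrier = carrier L, eq = (=), le = (\<lambda>x y. core_labels L x \<subseteq> core_labels L y)\<rparr>"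

definition order_isomorphic :: "('a, 'c) gorder_scheme \<Rightarrow> ('b, 'd) gorder_scheme \<Rightarrow> bool" where
  "order_isomorphic A B \<longleftrightarrow> (\<exists>f. bij_betw f (carrier A) (carrier B) \<and> order_emb A B f)"

definition powerset_order :: "'a set \<Rightarrow> 'a set gorder" where
  "powerset_order S = \<lparr>carrier = Pow S, eq = (=), le = (\<subseteq>)\<rparr>"

text \<open>Every finite set is in bijection with a finite set of natural numbers, so it suffices to
  let the ground set range over the latter.\<close>

definition boolean_lattice :: "('a, 'b) gorder_scheme \<Rightarrow> bool" where
  "boolean_lattice L \<longleftrightarrow> lattice L \<and>
     (\<exists>S :: nat set. finite S \<and> order_isomorphic L (powerset_order S))"

end

theory Submission
  imports Defs
begin

text \<open>In a finite distributive lattice every join-irreducible is join-prime, so the label of a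
  cover \<open>u \<lessdot> v\<close> is the unique join-irreducible below \<open>v\<close> but not below \<open>u\<close>.  It follows that
  \<open>\<Psi>(x)\<close> is the set of maximal join-irreducibles below \<open>x\<close>; by Birkhoff's correspondence between
  elements and order ideals of join-irreducibles, the sets \<open>\<Psi>(x)\<close> are exactly the antichains of
  join-irreducibles.  Antichains are closed under intersection.  If any two elements have an upper
  bound in the core label order, then any two join-irreducibles lie in a common antichain, so all of
  them are pairwise incomparable, which characterises Boolean lattices; in that case the core label
  order is the original order.\<close>

text \<open>A lattice over an explicit carrier may be empty. Its core label order is then trivially
  a lattice, yet no power set is empty, so the equivalence with Boolean lattices requires a nonempty
  carrier.\<close>

locale finite_distributive_lattice = distributive_lattice +
  assumes finite_carrier: "finite (carrier L)"
    and carrier_nonempty: "carrier L \<noteq> {}"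
begin

section \<open>Covers and extremal elements\<close>

lemma lless_iff: "x \<sqsubset> y \<longleftrightarrow> x \<sqsubseteq> y \<and> x \<noteq> y"
  by (simp add: lless_def eq_is_equal)

lemma join_irreducible_closed: "join_irreducible L j \<Longrightarrow> j \<in> carrier L"
  by (simp add: join_irreducible_def)

lemma join_irreducibleD:
  assumes "join_irreducible L j" "x \<in> carrier L" "y \<in> carrier L" "j = x \<squnion> y"
  shows "j = x \<or> j = y"
  using assms by (auto simp: join_irreducible_def)

lemma coversD:
  assumes "covers L u v"
  shows "u \<in> carrier L" "v \<in> carrier L" "u \<sqsubseteq> v" "u \<noteq> v"
    and "\<And>z. z \<in> carrier L \<Longrightarrow> u \<sqsubseteq> z \<Longrightarrow> z \<sqsubseteq> v \<Longrightarrow> z = u \<or> z = v"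
  using assms by (auto simp: covers_def lless_iff)

lemma minimal_exists:
  assumes "S \<subseteq> carrier L" "S \<noteq> {}"
  obtains m where "m \<in> S" "\<And>z. z \<in> S \<Longrightarrow> z \<sqsubseteq> m \<Longrightarrow> z = m"
proof -
  have "asymp_on S (\<lambda>x y. x \<sqsubset> y)" "transp_on S (\<lambda>x y. x \<sqsubset> y)"
    using assms(1) le_antisym
    by (auto simp: asymp_on_def transp_on_def lless_iff subset_iff intro: le_trans)
  then show ?thesis
    using Finite_Set.bex_min_element[of S "\<lambda>x y. x \<sqsubset> y"] finite_subset[OF assms(1) finite_carrier]
      assms(2) that
    by (auto simp: lless_iff)
qed

lemma maximal_exists:
  assumes "S \<subseteq> carrier L" "S \<noteq> {}"
  obtains m where "m \<in> S" "\<And>z. z \<in> S \<Longrightarrow> m \<sqsubseteq> z \<Longrightarrow> z = m"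
proof -
  have "asymp_on S (\<lambda>x y. y \<sqsubset> x)" "transp_on S (\<lambda>x y. y \<sqsubset> x)"
    using assms(1) le_antisym
    by (auto simp: asymp_on_def transp_on_def lless_iff subset_iff intro: le_trans)
  then show ?thesis
    using Finite_Set.bex_min_element[of S "\<lambda>x y. y \<sqsubset> x"] finite_subset[OF assms(1) finite_carrier]
      assms(2) that
    by (auto simp: lless_iff)
qed

text \<open>A minimal \<open>b\<close> is already least, since \<open>b \<sqinter> x\<close> lies
  below \<open>b\<close> and hence equals it.\<close>

lemma least_exists: "\<exists>b. least L b (carrier L)"
proof -
  obtain b where b: "b \<in> carrier L" "\<And>z. z \<in> carrier L \<Longrightarrow> z \<sqsubseteq> b \<Longrightarrow> z = b"
    using minimal_exists[of "carrier L"] carrier_nonempty by blast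
  have "b \<sqsubseteq> x" if "x \<in> carrier L" for x
    using b(2)[of "b \<sqinter> x"] that b(1) meet_left meet_right meet_closed by metis
  then show ?thesis
    using b(1) by (auto simp: least_def)
qed

section \<open>Join-irreducibles: primeness and separation\<close>

lemma join_irreducible_join_le_iff:
  assumes j: "join_irreducible L j" and xy: "x \<in> carrier L" "y \<in> carrier L"
  shows "j \<sqsubseteq> x \<squnion> y \<longleftrightarrow> j \<sqsubseteq> x \<or> j \<sqsubseteq> y"
proof
  note jc = join_irreducible_closed[OF j]
  assume "j \<sqsubseteq> x \<squnion> y"
  then have "j \<sqinter> (x \<squnion> y) = j"
    by (intro le_antisym) (use jc xy in \<open>auto intro: meet_left meet_le\<close>)
  \<comment> \<open>Distributivity enters the development here: it splits \<open>j\<close> along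
    \<open>x\<close> and \<open>y\<close>, and irreducibility then puts \<open>j\<close> below one
    of them.\<close>
  then have "j = (j \<sqinter> x) \<squnion> (j \<sqinter> y)"
    using meet_join_distrib[OF jc xy] by simp
  then have "j = j \<sqinter> x \<or> j = j \<sqinter> y"
    by (intro join_irreducibleD[OF j]) (use jc xy in auto)
  then show "j \<sqsubseteq> x \<or> j \<sqsubseteq> y"
    using meet_right[OF jc xy(1)] meet_right[OF jc xy(2)] by auto
next
  assume "j \<sqsubseteq> x \<or> j \<sqsubseteq> y"
  then show "j \<sqsubseteq> x \<squnion> y"
    using join_irreducible_closed[OF j] xy join_left join_right join_closed le_trans by meson
qed

text \<open>Take \<open>j\<close> minimal among the elements below \<open>x\<close> but not below
  \<open>y\<close>. If \<open>j\<close> were a join of two smaller elements, both would be below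
  \<open>y\<close>, and so would \<open>j\<close>. The last conclusion records this minimality; it
  later identifies the lower cover of \<open>j\<close>.\<close>

lemma separating_join_irreducible:
  assumes "x \<in> carrier L" "y \<in> carrier L" "\<not> x \<sqsubseteq> y"
  obtains j where "join_irreducible L j" "j \<sqsubseteq> x" "\<not> j \<sqsubseteq> y"
    "\<And>w. w \<in> carrier L \<Longrightarrow> w \<sqsubseteq> j \<Longrightarrow> w \<noteq> j \<Longrightarrow> w \<sqsubseteq> y"
proof -
  let ?S = "{z \<in> carrier L. z \<sqsubseteq> x \<and> \<not> z \<sqsubseteq> y}"
  have "x \<in> ?S"
    using assms by simp
  then obtain j where j: "j \<in> ?S" "\<And>z. z \<in> ?S \<Longrightarrow> z \<sqsubseteq> j \<Longrightarrow> z = j"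
    using minimal_exists[of ?S] by blast
  have below: "w \<sqsubseteq> y" if "w \<in> carrier L" "w \<sqsubseteq> j" "w \<noteq> j" for w
    using j that assms le_trans[of w j x] by blast
  have "j \<in> {a, b}" if ab: "a \<in> carrier L" "b \<in> carrier L" "j = a \<squnion> b" for a b
    using below[of a] below[of b] join_left[OF ab(1,2)] join_right[OF ab(1,2)]
      join_le[of a y b] ab j(1) assms(2) by auto
  then have "join_irreducible L j"
    using j(1) assms(2) by (auto simp: join_irreducible_def least_def)
  then show ?thesis
    using that j(1) below by blast
qed

text \<open>This is the embedding half of Birkhoff's representation; separation gives the direction
  from right to left.\<close>

lemma le_iff_join_irreducibles:
  assumes "x \<in> carrier L" "y \<in> carrier L"
  shows "x \<sqsubseteq> y \<longleftrightarrow> (\<forall>j. join_irreducible L j \<longrightarrow> j \<sqsubseteq> x \<longrightarrow> j \<sqsubseteq> y)"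
  using assms separating_join_irreducible[OF assms] join_irreducible_closed le_trans by metis

section \<open>Labels of cover relations\<close>

lemma join_covers_eq:
  assumes "covers L u v" "j \<in> carrier L" "j \<sqsubseteq> v" "\<not> j \<sqsubseteq> u"
  shows "j \<squnion> u = v"
  using coversD[OF assms(1)] assms(2-4) join_left join_right join_closed join_le by metis

text \<open>Both \<open>j \<squnion> u\<close> and \<open>k \<squnion> u\<close> equal
  \<open>v\<close>, so \<open>j\<close> is below \<open>k \<squnion> u\<close>. As \<open>j\<close>
  is prime and not below \<open>u\<close>, it is below \<open>k\<close>; the converse is
  symmetric.\<close>

lemma join_irreducible_between_covers_unique:
  assumes "covers L u v"
    and "join_irreducible L j" "j \<sqsubseteq> v" "\<not> j \<sqsubseteq> u"
    and "join_irreducible L k" "k \<sqsubseteq> v" "\<not> k \<sqsubseteq> u"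
  shows "j = k"
proof -
  note closed = join_irreducible_closed[OF assms(2)] join_irreducible_closed[OF assms(5)]
  have "j \<squnion> u = v" "k \<squnion> u = v"
    using join_covers_eq assms closed by auto
  then have "j \<sqsubseteq> k" "k \<sqsubseteq> j"
    using assms closed coversD(1)[OF assms(1)] join_irreducible_join_le_iff by metis+
  then show ?thesis
    using closed le_antisym by blast
qed

text \<open>The alternative with \<open>j\<close> as the upper join makes \<open>j\<close> a join of
  its lower cover and \<open>v\<close>. Irreducibility forces \<open>j = v\<close>, the two covers
  coincide, and the other alternative holds as well.\<close>

lemma perspective_lower_coverD:
  assumes j: "join_irreducible L j" and p: "perspective L (u, v) (lower_cover L j, j)"
  shows "j \<sqsubseteq> v" "\<not> j \<sqsubseteq> u"
proof -
  let ?l = "lower_cover L j"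
  have uv: "covers L u v" and l: "covers L ?l j"
    using p by (auto simp: perspective_def)
  note c = coversD(1,2)[OF uv] coversD(1,2)[OF l]
  have "j \<squnion> u = v \<and> j \<sqinter> u = ?l"
  proof (rule ccontr)
    assume neg: "\<not> ?thesis"
    then have e: "?l \<squnion> v = j" "?l \<sqinter> v = u"
      using p by (auto simp: perspective_def)
    then have "j = v"
      using join_irreducibleD[OF j c(3,2)] coversD(4)[OF l] by auto
    then have "?l = u"
      using e c coversD(3)[OF l] meet_left meet_le le_antisym le_refl by metis
    then show False
      using neg \<open>j = v\<close> e by (simp add: join_comm meet_comm)
  qed
  then show "j \<sqsubseteq> v"
    using join_left c by metis
  show "\<not> j \<sqsubseteq> u"
  proof
    assume "j \<sqsubseteq> u"
    then have "j \<sqsubseteq> ?l"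
      using \<open>j \<squnion> u = v \<and> j \<sqinter> u = ?l\<close> meet_le[of j j u] c by simp
    then show False
      using coversD(3,4)[OF l] c le_antisym by blast
  qed
qed

text \<open>Choose \<open>j\<close> minimal below \<open>v\<close> and not below \<open>u\<close>.
  Everything strictly below \<open>j\<close> is below \<open>u\<close>, so
  \<open>j \<sqinter> u\<close> is the greatest element strictly below \<open>j\<close>, hence its
  unique lower cover. With \<open>j \<squnion> u = v\<close> this is perspectivity.\<close>

lemma cover_label_exists:
  assumes uv: "covers L u v"
  obtains j where "join_irreducible L j" "perspective L (u, v) (lower_cover L j, j)"
proof -
  note c = coversD(1,2)[OF uv]
  have "\<not> v \<sqsubseteq> u"
    using coversD(3,4)[OF uv] c le_antisym by blast
  then obtain j where j: "join_irreducible L j" "j \<sqsubseteq> v" "\<not> j \<sqsubseteq> u"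
    and below: "\<And>w. w \<in> carrier L \<Longrightarrow> w \<sqsubseteq> j \<Longrightarrow> w \<noteq> j \<Longrightarrow> w \<sqsubseteq> u"
    using separating_join_irreducible[OF c(2,1)] by blast
  note jc = join_irreducible_closed[OF j(1)]
  have lt: "j \<sqinter> u \<sqsubseteq> j" "j \<sqinter> u \<noteq> j"
    using meet_left[OF jc c(1)] meet_right[OF jc c(1)] j(3) by auto
  have max: "w \<sqsubseteq> j \<sqinter> u" if "w \<in> carrier L" "w \<sqsubseteq> j" "w \<noteq> j" for w
    using meet_le[of w j u] below[OF that] that jc c by blast
  have cov: "covers L (j \<sqinter> u) j"
    unfolding covers_def lless_iff using lt max jc c meet_closed le_antisym by blast
  have "k = j \<sqinter> u" if "covers L k j" for k
    using coversD[OF that] max[of k] lt meet_closed[OF jc c(1)] by blast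
  then have "lower_cover L j = j \<sqinter> u"
    unfolding lower_cover_def using cov by (intro the_equality)
  then have "perspective L (u, v) (lower_cover L j, j)"
    using uv cov join_covers_eq[OF uv jc j(2,3)] by (simp add: perspective_def)
  then show ?thesis
    using that j(1) by blast
qed

text \<open>Justifies the definite description: any two candidates lie below \<open>v\<close> but
  not below \<open>u\<close>, hence agree. From here on labels are handled through this position
  relative to \<open>u\<close> and \<open>v\<close>, without perspectivity.\<close>

lemma cover_label_spec:
  assumes uv: "covers L u v"
  shows "join_irreducible L (cover_label L u v)" "cover_label L u v \<sqsubseteq> v"
    "\<not> cover_label L u v \<sqsubseteq> u"
proof -
  obtain j where j: "join_irreducible L j" "perspective L (u, v) (lower_cover L j, j)"
    using cover_label_exists[OF uv] .
  have "cover_label L u v = j"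
    unfolding cover_label_def
  proof (rule the_equality)
    fix k
    assume k: "join_irreducible L k \<and> perspective L (u, v) (lower_cover L k, k)"
    then show "k = j"
      using join_irreducible_between_covers_unique[OF uv, of k j]
        perspective_lower_coverD[of k u v] perspective_lower_coverD[of j u v] j by simp
  qed (use j in simp)
  then show "join_irreducible L (cover_label L u v)" "cover_label L u v \<sqsubseteq> v"
    "\<not> cover_label L u v \<sqsubseteq> u"
    using j perspective_lower_coverD by auto
qed

lemma cover_label_eqI:
  assumes "covers L u v" "join_irreducible L j" "j \<sqsubseteq> v" "\<not> j \<sqsubseteq> u"
  shows "cover_label L u v = j"
  using join_irreducible_between_covers_unique[OF assms(1)] cover_label_spec[OF assms(1)] assms(2-4)
  by blast

section \<open>The nucleus and the core labels\<close>

lemma nucleus_closed: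
  assumes "x \<in> carrier L"
  shows "nucleus L x \<in> carrier L"
proof -
  have "{y. covers L y x} \<subseteq> carrier L"
    using coversD by blast
  then show ?thesis
    using assms finite_subset[OF _ finite_carrier] by (auto simp: nucleus_def intro!: finite_inf_closed)
qed

text \<open>The conjunct \<open>j \<sqsubseteq> x\<close> handles the default value of the nucleus
  at an element without lower covers; otherwise it follows from the second conjunct.\<close>

lemma le_nucleus_iff:
  assumes "x \<in> carrier L" "j \<in> carrier L"
  shows "j \<sqsubseteq> nucleus L x \<longleftrightarrow> j \<sqsubseteq> x \<and> (\<forall>y. covers L y x \<longrightarrow> j \<sqsubseteq> y)"
proof (cases "\<exists>y. covers L y x")
  case True
  let ?C = "{y. covers L y x}"
  have C: "?C \<subseteq> carrier L"
    using coversD by blast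
  then have g: "greatest L (nucleus L x) (Lower L ?C)"
    using True finite_subset[OF C finite_carrier] finite_inf_greatest[of ?C]
    by (auto simp: nucleus_def)
  have "j \<sqsubseteq> nucleus L x \<longleftrightarrow> (\<forall>y\<in>?C. j \<sqsubseteq> y)"
  proof
    assume "j \<sqsubseteq> nucleus L x"
    then show "\<forall>y\<in>?C. j \<sqsubseteq> y"
      using greatest_Lower_below[OF g] C assms nucleus_closed le_trans by blast
  next
    assume "\<forall>y\<in>?C. j \<sqsubseteq> y"
    then have "j \<in> Lower L ?C"
      using assms C by (auto simp: Lower_def)
    then show "j \<sqsubseteq> nucleus L x"
      using greatest_le[OF g] by blast
  qed
  then show ?thesis
    using True assms coversD le_trans by blast
next
  case False
  then show ?thesis
    by (simp add: nucleus_def)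
qed

text \<open>Take \<open>y\<close> maximal among the elements below \<open>x\<close> that are not
  above \<open>j\<close>. For \<open>z\<close> strictly between \<open>y\<close> and
  \<open>x\<close>, some join-irreducible \<open>k\<close> is below \<open>x\<close> but not below
  \<open>z\<close>. Then \<open>y \<squnion> k\<close> is above \<open>j\<close>, so primeness and
  maximality give \<open>k = j\<close>, although \<open>j\<close> is below \<open>z\<close>.\<close>

lemma lower_cover_avoiding_maximal:
  assumes x: "x \<in> carrier L" and j: "join_irreducible L j" "j \<sqsubseteq> x"
    and max: "\<And>k. join_irreducible L k \<Longrightarrow> k \<sqsubseteq> x \<Longrightarrow> j \<sqsubseteq> k \<Longrightarrow> k = j"
  obtains y where "covers L y x" "\<not> j \<sqsubseteq> y"
proof -
  note jc = join_irreducible_closed[OF j(1)]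
  let ?S = "{z \<in> carrier L. z \<sqsubseteq> x \<and> \<not> j \<sqsubseteq> z}"
  obtain b where b: "least L b (carrier L)"
    using least_exists by blast
  \<comment> \<open>The least element is a candidate because a join-irreducible is never
    least.\<close>
  then have "b \<in> ?S"
    using x j jc le_antisym by (auto simp: least_def join_irreducible_def)
  then obtain y where y: "y \<in> ?S" "\<And>z. z \<in> ?S \<Longrightarrow> y \<sqsubseteq> z \<Longrightarrow> z = y"
    using maximal_exists[of ?S] by blast
  have "\<not> (y \<sqsubset> z \<and> z \<sqsubset> x)" if z: "z \<in> carrier L" for z
  proof
    assume "y \<sqsubset> z \<and> z \<sqsubset> x"
    then have yz: "y \<sqsubseteq> z" "y \<noteq> z" and zx: "z \<sqsubseteq> x" "z \<noteq> x"
      by (auto simp: lless_iff)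
    have "j \<sqsubseteq> z"
      using y yz zx z by blast
    have "\<not> x \<sqsubseteq> z"
      using zx x z le_antisym by blast
    then obtain k where k: "join_irreducible L k" "k \<sqsubseteq> x" "\<not> k \<sqsubseteq> z"
      using separating_join_irreducible[OF x z] by metis
    note kc = join_irreducible_closed[OF k(1)]
    have yc: "y \<in> carrier L" "y \<sqsubseteq> x" "\<not> j \<sqsubseteq> y"
      using y(1) by auto
    have "\<not> k \<sqsubseteq> y"
      using k(3) yz(1) kc yc z le_trans by blast
    then have "y \<squnion> k \<noteq> y"
      using join_right yc kc by metis
    moreover have "y \<squnion> k \<sqsubseteq> x" "y \<sqsubseteq> y \<squnion> k"
      using join_le join_left x yc kc k by auto
    ultimately have "j \<sqsubseteq> y \<squnion> k"
      using y(2)[of "y \<squnion> k"] join_closed yc kc by blast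
    then have "k = j"
      using join_irreducible_join_le_iff[OF j(1) yc(1) kc] yc max k by blast
    then show False
      using \<open>j \<sqsubseteq> z\<close> k by blast
  qed
  then have "covers L y x"
    using x y(1) j(2) by (auto simp: covers_def lless_iff)
  then show ?thesis
    using that y(1) by blast
qed

theorem core_labels_eq_maximal_join_irreducibles:
  assumes x: "x \<in> carrier L"
  shows "core_labels L x = {j. join_irreducible L j \<and> j \<sqsubseteq> x \<and>
    (\<forall>k. join_irreducible L k \<longrightarrow> k \<sqsubseteq> x \<longrightarrow> j \<sqsubseteq> k \<longrightarrow> k = j)}" (is "_ = ?M")
proof
  show "core_labels L x \<subseteq> ?M"
  proof
    fix j
    assume "j \<in> core_labels L x"
    then obtain u v where uv: "nucleus L x \<sqsubseteq> u" "covers L u v" "v \<sqsubseteq> x" "j = cover_label L u v"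
      by (auto simp: core_labels_def)
    note c = coversD(1,2)[OF uv(2)]
    have j: "join_irreducible L j" "j \<sqsubseteq> v" "\<not> j \<sqsubseteq> u"
      using cover_label_spec[OF uv(2)] uv(4) by auto
    note jc = join_irreducible_closed[OF j(1)]
    have jx: "j \<sqsubseteq> x"
      using j(2) uv(3) jc c x le_trans by blast
    have "k = j" if k: "join_irreducible L k" "k \<sqsubseteq> x" "j \<sqsubseteq> k" for k
    proof (rule ccontr)
      assume "k \<noteq> j"
      \<comment> \<open>A lower cover \<open>y\<close> not above \<open>j\<close> is not above
        \<open>k\<close> either, so both would lie between \<open>y\<close> and \<open>x\<close> and
        coincide. Hence \<open>j\<close> is below the nucleus and so below \<open>u\<close>,
        contradicting that it labels the cover from \<open>u\<close> to \<open>v\<close>.\<close>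
      have "j \<sqsubseteq> y" if y: "covers L y x" for y
      proof (rule ccontr)
        assume "\<not> j \<sqsubseteq> y"
        then have "\<not> k \<sqsubseteq> y"
          using k jc join_irreducible_closed[OF k(1)] coversD(1)[OF y] le_trans by blast
        then show False
          using \<open>\<not> j \<sqsubseteq> y\<close> \<open>k \<noteq> j\<close> k j jx join_irreducible_between_covers_unique[OF y] by blast
      qed
      then have "j \<sqsubseteq> nucleus L x"
        using le_nucleus_iff[OF x jc] jx by blast
      then show False
        using j(3) uv(1) jc c nucleus_closed[OF x] le_trans by blast
    qed
    then show "j \<in> ?M"
      using j jx by blast
  qed
next
  show "?M \<subseteq> core_labels L x"
  proof
    fix j
    assume "j \<in> ?M"
    then have j: "join_irreducible L j" "j \<sqsubseteq> x"
      and max: "\<And>k. join_irreducible L k \<Longrightarrow> k \<sqsubseteq> x \<Longrightarrow> j \<sqsubseteq> k \<Longrightarrow> k = j"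
      by auto
    \<comment> \<open>For a maximal \<open>j\<close> a cover with top \<open>x\<close> suffices, and
      its bottom is above the nucleus.\<close>
    obtain y where y: "covers L y x" "\<not> j \<sqsubseteq> y"
      using lower_cover_avoiding_maximal[OF x j max] by blast
    have "nucleus L x \<sqsubseteq> y"
      using le_nucleus_iff[OF x nucleus_closed[OF x]] nucleus_closed[OF x] y(1) by blast
    then show "j \<in> core_labels L x"
      unfolding core_labels_def using y cover_label_eqI[OF y(1) j y(2)] x by force
  qed
qed

section \<open>Elements as antichains of join-irreducibles\<close>

lemma core_labels_antichain:
  assumes "x \<in> carrier L" "j \<in> core_labels L x" "k \<in> core_labels L x" "j \<sqsubseteq> k"
  shows "j = k"
  using assms core_labels_eq_maximal_join_irreducibles by auto

text \<open>A maximal join-irreducible between \<open>j\<close> and \<open>x\<close> is maximal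
  among all those below \<open>x\<close>, since whatever lies above it also lies above
  \<open>j\<close>.\<close>

lemma core_labels_above:
  assumes x: "x \<in> carrier L" and j: "join_irreducible L j" "j \<sqsubseteq> x"
  obtains k where "k \<in> core_labels L x" "j \<sqsubseteq> k"
proof -
  let ?S = "{k. join_irreducible L k \<and> j \<sqsubseteq> k \<and> k \<sqsubseteq> x}"
  have "?S \<subseteq> carrier L" "j \<in> ?S"
    using j join_irreducible_closed by auto
  then obtain k where k: "k \<in> ?S" "\<And>z. z \<in> ?S \<Longrightarrow> k \<sqsubseteq> z \<Longrightarrow> z = k"
    using maximal_exists[of ?S] by blast
  have "j \<sqsubseteq> z" if "join_irreducible L z" "k \<sqsubseteq> z" for z
    using that k(1) le_trans[of j k z] join_irreducible_closed[of j] join_irreducible_closed[of k]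
      join_irreducible_closed[of z] j(1) by simp
  then have "k \<in> core_labels L x"
    using core_labels_eq_maximal_join_irreducibles[OF x] k by blast
  then show ?thesis
    using that k(1) by blast
qed

text \<open>The join-irreducibles below \<open>x\<close> form the down-set generated by its core
  labels. Consequently the core labels determine \<open>x\<close>.\<close>

lemma core_labels_subset_imp_le:
  assumes "x \<in> carrier L" "y \<in> carrier L" "core_labels L x \<subseteq> core_labels L y"
  shows "x \<sqsubseteq> y"
proof -
  have "j \<sqsubseteq> y" if j: "join_irreducible L j" "j \<sqsubseteq> x" for j
  proof -
    obtain k where "k \<in> core_labels L x" "j \<sqsubseteq> k"
      using core_labels_above[OF assms(1) j] .
    moreover from this have "join_irreducible L k" "k \<sqsubseteq> y"
      using assms(3) core_labels_eq_maximal_join_irreducibles[OF assms(2)] by auto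
    ultimately show ?thesis
      using le_trans[of j k y] join_irreducible_closed[of j] join_irreducible_closed[of k]
        j(1) assms(2) by simp
  qed
  then show ?thesis
    using le_iff_join_irreducibles assms by blast
qed

text \<open>The witness is the join of \<open>A\<close>, built by insertion from the least element.
  Primeness ensures that no join-irreducible is below it except those below a member of
  \<open>A\<close>.\<close>

lemma element_of_join_irreducibles:
  assumes "finite A" "\<And>a. a \<in> A \<Longrightarrow> join_irreducible L a"
  shows "\<exists>z\<in>carrier L. \<forall>j. join_irreducible L j \<longrightarrow> (j \<sqsubseteq> z \<longleftrightarrow> (\<exists>a\<in>A. j \<sqsubseteq> a))"
  using assms
proof (induction A rule: finite_induct)
  case empty
  obtain b where b: "least L b (carrier L)"
    using least_exists by blast
  then have "\<not> j \<sqsubseteq> b" if "join_irreducible L j" for j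
    using that le_antisym by (auto simp: least_def join_irreducible_def)
  then show ?case
    using b by (auto simp: least_def)
next
  case (insert a A)
  then obtain z where z: "z \<in> carrier L"
    "\<And>j. join_irreducible L j \<Longrightarrow> j \<sqsubseteq> z \<longleftrightarrow> (\<exists>a\<in>A. j \<sqsubseteq> a)"
    by auto
  have a: "a \<in> carrier L"
    using insert.prems join_irreducible_closed by blast
  then show ?case
    using z join_irreducible_join_le_iff[OF _ a z(1)] by (intro bexI[of _ "a \<squnion> z"]) auto
qed

text \<open>The join of \<open>A\<close> has exactly the down-set generated by \<open>A\<close> as
  its join-irreducibles, and the maximal elements of that down-set are \<open>A\<close>
  itself.\<close>

lemma antichain_eq_core_labels:
  assumes A: "\<And>a. a \<in> A \<Longrightarrow> join_irreducible L a"
    and anti: "\<And>a b. a \<in> A \<Longrightarrow> b \<in> A \<Longrightarrow> a \<sqsubseteq> b \<Longrightarrow> a = b"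
  shows "\<exists>z\<in>carrier L. core_labels L z = A"
proof -
  have "finite A"
    using A join_irreducible_closed finite_subset[OF _ finite_carrier] by blast
  then obtain z where z: "z \<in> carrier L"
    "\<And>j. join_irreducible L j \<Longrightarrow> j \<sqsubseteq> z \<longleftrightarrow> (\<exists>a\<in>A. j \<sqsubseteq> a)"
    using element_of_join_irreducibles A by blast
  have Az: "a \<sqsubseteq> z" if "a \<in> A" for a
    using z(2)[OF A[OF that]] that le_refl[OF join_irreducible_closed[OF A[OF that]]] by blast
  have "core_labels L z = A"
  proof
    show "core_labels L z \<subseteq> A"
      using core_labels_eq_maximal_join_irreducibles[OF z(1)] z(2) Az A by blast
    show "A \<subseteq> core_labels L z"
    proof
      fix a
      assume a: "a \<in> A"
      have "k = a" if k: "join_irreducible L k" "k \<sqsubseteq> z" "a \<sqsubseteq> k" for k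
      proof -
        obtain b where b: "b \<in> A" "k \<sqsubseteq> b"
          using z(2) k by blast
        note c = A[OF a, THEN join_irreducible_closed] A[OF b(1), THEN join_irreducible_closed]
          join_irreducible_closed[OF k(1)]
        have "a = b"
          using anti[OF a b(1)] le_trans[OF k(3) b(2)] c by blast
        then show ?thesis
          using k b c le_antisym by blast
      qed
      then show "a \<in> core_labels L z"
        using core_labels_eq_maximal_join_irreducibles[OF z(1)] A[OF a] Az[OF a] by simp
    qed
  qed
  then show ?thesis
    using z(1) by blast
qed

section \<open>The intersection property and meets in the core label order\<close>

theorem intersection_property: "intersection_property L"
  unfolding intersection_property_def
proof (intro ballI)
  fix x y
  assume xy: "x \<in> carrier L" "y \<in> carrier L"
  \<comment> \<open>A subset of an antichain is an antichain, so the intersection is again a set of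
    core labels.\<close>
  have "\<exists>z\<in>carrier L. core_labels L z = core_labels L x \<inter> core_labels L y"
  proof (rule antichain_eq_core_labels)
    show "join_irreducible L a" if "a \<in> core_labels L x \<inter> core_labels L y" for a
      using that core_labels_eq_maximal_join_irreducibles[OF xy(1)] by blast
    show "a = b" if "a \<in> core_labels L x \<inter> core_labels L y" "b \<in> core_labels L x \<inter> core_labels L y"
      "a \<sqsubseteq> b" for a b
      using that core_labels_antichain[OF xy(1)] by blast
  qed
  then show "\<exists>z\<in>carrier L. core_labels L x \<inter> core_labels L y = core_labels L z"
    by metis
qed

lemma CLO_partial_order: "partial_order (CLO L)"
proof unfold_locales
  fix x y
  assume "x \<sqsubseteq>\<^bsub>CLO L\<^esub> y" "y \<sqsubseteq>\<^bsub>CLO L\<^esub> x" "x \<in> carrier (CLO L)" "y \<in> carrier (CLO L)"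
  then show "x .=\<^bsub>CLO L\<^esub> y"
    using core_labels_subset_imp_le le_antisym by (simp add: CLO_def)
qed (auto simp: CLO_def)

theorem CLO_lower_semilattice: "lower_semilattice (CLO L)"
proof -
  interpret C: partial_order "CLO L"
    by (rule CLO_partial_order)
  show ?thesis
  proof unfold_locales
    fix x y
    assume xy: "x \<in> carrier (CLO L)" "y \<in> carrier (CLO L)"
    then obtain z where "z \<in> carrier L" "core_labels L x \<inter> core_labels L y = core_labels L z"
      using intersection_property unfolding intersection_property_def CLO_def by force
    \<comment> \<open>A label set contained in both given ones is contained in their intersection,
      so \<open>z\<close> is the meet.\<close>
    then have "greatest (CLO L) z (Lower (CLO L) {x, y})"
      using xy by (auto simp: greatest_def Lower_def CLO_def)
    then show "\<exists>s. greatest (CLO L) s (Lower (CLO L) {x, y})" ..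
  qed
qed

section \<open>When the core label order is a lattice\<close>

lemma core_labels_join_irreducible:
  assumes "join_irreducible L j"
  shows "j \<in> core_labels L j"
  using assms core_labels_eq_maximal_join_irreducibles[of j] join_irreducible_closed le_antisym
  by auto

text \<open>An upper bound of \<open>j\<close> and \<open>k\<close> in the core label order has both
  among its core labels, which form an antichain.\<close>

lemma join_irreducibles_antichain_if_CLO_lattice:
  assumes "lattice (CLO L)" and j: "join_irreducible L j" and k: "join_irreducible L k"
    and le: "j \<sqsubseteq> k"
  shows "j = k"
proof -
  interpret C: lattice "CLO L"
    by fact
  have c: "j \<in> carrier (CLO L)" "k \<in> carrier (CLO L)"
    using j k join_irreducible_closed by (auto simp: CLO_def)
  then obtain s where "least (CLO L) s (Upper (CLO L) {j, k})"
    using C.sup_of_two_exists by blast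
  then have "s \<in> carrier L" "core_labels L j \<subseteq> core_labels L s" "core_labels L k \<subseteq> core_labels L s"
    using c by (auto simp: least_def Upper_def CLO_def)
  then show ?thesis
    using core_labels_antichain[of s j k] core_labels_join_irreducible j k le by blast
qed

text \<open>Every join-irreducible below \<open>x\<close> is now maximal, so the core label order
  coincides with the order of \<open>L\<close> and inherits its joins.\<close>

lemma CLO_lattice_if_join_irreducibles_antichain:
  assumes "\<And>j k. join_irreducible L j \<Longrightarrow> join_irreducible L k \<Longrightarrow> j \<sqsubseteq> k \<Longrightarrow> j = k"
  shows "lattice (CLO L)"
proof -
  interpret C: lower_semilattice "CLO L"
    by (rule CLO_lower_semilattice)
  have labels: "core_labels L x = {j. join_irreducible L j \<and> j \<sqsubseteq> x}" if "x \<in> carrier L" for x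
    using core_labels_eq_maximal_join_irreducibles[OF that] assms by blast
  have le: "x \<sqsubseteq>\<^bsub>CLO L\<^esub> y \<longleftrightarrow> x \<sqsubseteq> y" if "x \<in> carrier L" "y \<in> carrier L" for x y
    using labels that le_iff_join_irreducibles[OF that] by (auto simp: CLO_def)
  have carrier: "carrier (CLO L) = carrier L"
    by (simp add: CLO_def)
  show ?thesis
  proof unfold_locales
    fix x y
    assume "x \<in> carrier (CLO L)" "y \<in> carrier (CLO L)"
    then have xy: "x \<in> carrier L" "y \<in> carrier L"
      by (auto simp: carrier)
    then have "least (CLO L) (x \<squnion> y) (Upper (CLO L) {x, y})"
      using join_le[of x _ y] by (auto simp: least_def Upper_def carrier le join_left join_right)
    then show "\<exists>s. least (CLO L) s (Upper (CLO L) {x, y})" ..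
  qed
qed

lemma join_irreducibles_antichain_if_boolean:
  assumes "boolean_lattice L" and j: "join_irreducible L j" and k: "join_irreducible L k"
    and jk: "j \<sqsubseteq> k"
  shows "j = k"
proof (rule ccontr)
  assume "j \<noteq> k"
  obtain S :: "nat set" and f where bij: "bij_betw f (carrier L) (Pow S)"
    and emb: "\<And>x y. x \<in> carrier L \<Longrightarrow> y \<in> carrier L \<Longrightarrow> f x \<subseteq> f y \<longleftrightarrow> x \<sqsubseteq> y"
    using assms(1)
    by (auto simp: boolean_lattice_def order_isomorphic_def order_emb_def powerset_order_def)
  note c = join_irreducible_closed[OF j] join_irreducible_closed[OF k]
  \<comment> \<open>The relative complement of \<open>j\<close> in \<open>k\<close> writes
    \<open>k\<close> as a join. As \<open>k\<close> is irreducible and differs from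
    \<open>j\<close>, it equals that complement, so \<open>f j\<close> is empty and \<open>j\<close>
    would be least.\<close>
  have "f k - f j \<in> Pow S"
    using bij c by (auto simp: bij_betw_def)
  then obtain x where x: "x \<in> carrier L" "f x = f k - f j"
    using bij by (metis bij_betw_def imageE)
  have jx: "j \<squnion> x \<in> carrier L"
    using c x by simp
  have "f j \<subseteq> f (j \<squnion> x)" "f x \<subseteq> f (j \<squnion> x)"
    using emb[OF c(1) jx] emb[OF x(1) jx] join_left[OF c(1) x(1)] join_right[OF c(1) x(1)] by blast+
  then have "k \<sqsubseteq> j \<squnion> x"
    using emb[OF c(2) jx] x(2) by blast
  moreover have "x \<sqsubseteq> k"
    using emb[OF x(1) c(2)] x(2) by blast
  ultimately have "k = j \<squnion> x"
    using join_le[OF jk] c x(1) jx le_antisym by blast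
  then have "k = x"
    using join_irreducibleD[OF k c(1) x(1)] \<open>j \<noteq> k\<close> by auto
  then have "f j = {}"
    using x(2) emb[OF c] jk by blast
  then have "least L j (carrier L)"
    using emb[OF c(1)] c(1) by (auto simp: least_def)
  then show False
    using j by (simp add: join_irreducible_def)
qed

text \<open>Every set of join-irreducibles is an antichain, hence the core labels of some element;
  this makes Birkhoff's embedding onto the whole power set.\<close>

lemma boolean_if_join_irreducibles_antichain:
  assumes anti: "\<And>j k. join_irreducible L j \<Longrightarrow> join_irreducible L k \<Longrightarrow> j \<sqsubseteq> k \<Longrightarrow> j = k"
  shows "boolean_lattice L"
proof -
  define J where "J = {j. join_irreducible L j}"
  have "finite J"
    using finite_subset[of J, OF _ finite_carrier] join_irreducible_closed by (auto simp: J_def)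
  \<comment> \<open>Renames the join-irreducibles, because \<open>boolean_lattice\<close> takes its
    ground set among the natural numbers.\<close>
  then obtain g :: "'a \<Rightarrow> nat" where g: "bij_betw g J {0..<card J}"
    using ex_bij_betw_finite_nat by blast
  define h where "h x = {j \<in> J. j \<sqsubseteq> x}" for x
  have h_mono: "h x \<subseteq> h y \<longleftrightarrow> x \<sqsubseteq> y" if "x \<in> carrier L" "y \<in> carrier L" for x y
    using le_iff_join_irreducibles[OF that] by (auto simp: h_def J_def)
  have h_core: "h x = core_labels L x" if "x \<in> carrier L" for x
    using core_labels_eq_maximal_join_irreducibles[OF that] anti by (auto simp: h_def J_def)
  have "bij_betw h (carrier L) (Pow J)"
    unfolding bij_betw_def
  proof
    show "inj_on h (carrier L)"
      by (rule inj_onI) (metis h_mono le_antisym order_refl)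
    have "A \<in> h ` carrier L" if A: "A \<subseteq> J" for A
    proof -
      have "\<exists>z\<in>carrier L. core_labels L z = A"
        using A anti by (intro antichain_eq_core_labels) (auto simp: J_def)
      then show ?thesis
        using h_core by force
    qed
    then show "h ` carrier L = Pow J"
      by (auto simp: h_def)
  qed
  then have bij: "bij_betw (\<lambda>x. g ` h x) (carrier L) (Pow {0..<card J})"
    using bij_betw_trans[OF _ bij_betw_Pow[OF g]] by (simp add: comp_def)
  have inj: "inj_on g J"
    using g by (rule bij_betw_imp_inj_on)
  have emb: "g ` h x \<subseteq> g ` h y \<longleftrightarrow> x \<sqsubseteq> y" if "x \<in> carrier L" "y \<in> carrier L" for x y
  proof -
    have "h x \<subseteq> J" "h y \<subseteq> J"
      by (auto simp: h_def)
    then have "g ` h x \<subseteq> g ` h y \<longleftrightarrow> h x \<subseteq> h y"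
      using inj_on_image_mem_iff[OF inj, of _ "h y"] by blast
    then show ?thesis
      using h_mono[OF that] by simp
  qed
  have "weak_partial_order (powerset_order {0..<card J})"
    by unfold_locales (auto simp: powerset_order_def)
  then have "order_emb L (powerset_order {0..<card J}) (\<lambda>x. g ` h x)"
    using emb weak_partial_order_axioms by (simp add: order_emb_def powerset_order_def)
  then have "order_isomorphic L (powerset_order {0..<card J})"
    unfolding order_isomorphic_def using bij by (auto simp: powerset_order_def)
  then show ?thesis
    unfolding boolean_lattice_def using lattice_axioms finite_atLeastLessThan by blast
qed

end

theorem theorem1p2:
  fixes L :: "('a, 'b) gorder_scheme"
  assumes "distributive_lattice L"
    and "finite (carrier L)"
    and "carrier L \<noteq> {}"
  shows "intersection_property L
    \<and> lower_semilattice (CLO L)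
    \<and> (lattice (CLO L) \<longleftrightarrow> boolean_lattice L)"
proof -
  interpret finite_distributive_lattice L
    using assms by (simp add: finite_distributive_lattice_def finite_distributive_lattice_axioms_def)
  \<comment> \<open>Both sides are equivalent to the join-irreducibles being pairwise
    incomparable.\<close>
  have "lattice (CLO L) \<longleftrightarrow> boolean_lattice L"
    using boolean_if_join_irreducibles_antichain join_irreducibles_antichain_if_CLO_lattice
      CLO_lattice_if_join_irreducibles_antichain join_irreducibles_antichain_if_boolean
    by blast
  then show ?thesis
    using intersection_property CLO_lower_semilattice by blast
qed

end
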